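(* For every $k\ge 2$, any deterministic $k$-way branching program computing $\mathrm{SumMod}^3_2(k)$ has at least $k^3$ states.
   Context: $T^3_2$ is the balanced rooted binary tree with 3 levels, nodes numbered heap-style: root $1$, children of $i$ are $2i,2i+1$ (leaves $4,5,6,7$). An input of $\mathrm{SumMod}^3_2(k)$ assigns to nodes $2$ and $3$ functions $f_2,f_3:[k]^2\to[k]$ (each given by its $k^2$ values, each a $k$-ary input variable) and to each leaf an element of $[k]$ (one variable each); the root function is fixed to be addition modulo $k$ (identifying $[k]$ with $\mathbb{Z}/k\mathbb{Z}$). Values: $v_i$ is the leaf label for a leaf and $v_i=f_i(v_{2i},v_{2i+1})$ for $i=2,3$; the output is $v_2+v_3 \bmod k$. A deterministic $k$-way branching program computing $g:[k]^m\to R$ is a directed rooted multigraph of states; each nonfinal state is labelled by a variable index and has exactly $k$ outedges labelled $1,\dots,k$; $|R|$ final sink states are labelled by elements of $R$; on input $x$ the computation starts at the root, follows from a state labelled $j$ the edge labelled $x_j$, and must reach the final state labelled $g(x)$. *)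

theory Defs
  imports "Graph_Theory.Arc_Walk" "HOL-Library.FuncSet"
begin

text \<open>
  Throughout, the alphabet \<open>[k]\<close> is represented by the standard residues \<open>{..<k}\<close>, so that it is
  identified with the integers modulo \<open>k\<close>.
\<close>

section \<open>Branching programs\<close>

text \<open>
  States are the vertices of a directed multigraph. The field \<open>query\<close> is meaningful only
  on nonfinal states and \<open>outcome\<close> only on final ones.
\<close>

record ('s, 'e, 'v, 'r) branching_program =
  graph :: "('s, 'e) pre_digraph"
  start :: 's
  final :: "'s set"
  query :: "'s \<Rightarrow> 'v"
  outcome :: "'s \<Rightarrow> 'r"
  elabel :: "'e \<Rightarrow> nat"

text \<open>
  A deterministic \<open>k\<close>-way branching program with input variables \<open>V\<close> and output range \<open>R\<close>.
  The bijection between \<open>final B\<close> and \<open>R\<close> says that there are exactly \<open>|R|\<close> final states,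
  labelled by the elements of \<open>R\<close>. States need not be reachable from the root, and the graph
  may contain cycles.
\<close>

definition deterministic_bp ::
  "nat \<Rightarrow> 'v set \<Rightarrow> 'r set \<Rightarrow> ('s, 'e, 'v, 'r) branching_program \<Rightarrow> bool" where
  "deterministic_bp k V R B \<longleftrightarrow>
     fin_digraph (graph B) \<and>
     start B \<in> verts (graph B) \<and>
     final B \<subseteq> verts (graph B) \<and>
     bij_betw (outcome B) (final B) R \<and>
     (\<forall>s \<in> final B. out_arcs (graph B) s = {}) \<and>
     (\<forall>s \<in> verts (graph B) - final B.
        query B s \<in> V \<and> bij_betw (elabel B) (out_arcs (graph B) s) {..<k})"

definition activated ::
  "('s, 'e, 'v, 'r) branching_program \<Rightarrow> ('v \<Rightarrow> nat) \<Rightarrow> 'e \<Rightarrow> bool" where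
  "activated B x e \<longleftrightarrow> elabel B e = x (query B (tail (graph B) e))"

text \<open>
  Final states are sinks and nonfinal states of a deterministic program have exactly one
  activated outedge, so an activated walk from the root to a final state is the
  computation on \<open>x\<close>.
\<close>

definition computes ::
  "nat \<Rightarrow> 'v set \<Rightarrow> ('s, 'e, 'v, 'r) branching_program \<Rightarrow> (('v \<Rightarrow> nat) \<Rightarrow> 'r) \<Rightarrow> bool" where
  "computes k V B g \<longleftrightarrow>
     (\<forall>x \<in> V \<rightarrow>\<^sub>E {..<k}. \<exists>p t.
        pre_digraph.awalk (graph B) (start B) p t \<and>
        (\<forall>e \<in> set p. activated B x e) \<and>
        t \<in> final B \<and> outcome B t = g x)"


section \<open>The problem SumMod on the binary tree with three levels\<close>

text \<open>
  \<open>Leaf i\<close> is the label of leaf \<open>i\<close>; \<open>Entry i a b\<close> is the table entry \<open>f\<^sub>i(a, b)\<close>.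
\<close>

datatype tree_var = Leaf nat | Entry nat nat nat

definition sum_mod_vars :: "nat \<Rightarrow> tree_var set" where
  "sum_mod_vars k =
     {Leaf i | i. i \<in> {4, 5, 6, 7}} \<union> {Entry i a b | i a b. i \<in> {2, 3} \<and> a < k \<and> b < k}"

definition node_value :: "(tree_var \<Rightarrow> nat) \<Rightarrow> nat \<Rightarrow> nat" where
  "node_value x i =
     (if i \<in> {4, 5, 6, 7} then x (Leaf i)
      else x (Entry i (x (Leaf (2 * i))) (x (Leaf (2 * i + 1)))))"

definition sum_mod :: "nat \<Rightarrow> (tree_var \<Rightarrow> nat) \<Rightarrow> nat" where
  "sum_mod k x = (node_value x 2 + node_value x 3) mod k"

end

theory Submission
  imports Defs
begin

text \<open>
  Fix a pair \<open>(a, b)\<close>, label the leaves so that both internal nodes read the entry at \<open>(a, b)\<close>, and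
  let all other table entries be zero. Then the program adds \<open>X = f\<^sub>2(a, b)\<close> and \<open>Y = f\<^sub>3(a, b)\<close>
  modulo \<open>k\<close>. The last arc of a computation that leaves a state querying \<open>X\<close> or \<open>Y\<close> reveals the
  value of one of them, and it determines the output since all later queries have fixed
  answers; hence it determines both values. So the states querying \<open>X\<close> or \<open>Y\<close> have at least
  \<open>k\<^sup>2\<close> outgoing arcs. Over all \<open>(a, b)\<close> this gives \<open>k\<^sup>4\<close> distinct arcs, while every state has at
  most \<open>k\<close>.
\<close>

text \<open>Distinct outedges of a nonfinal state carry distinct labels, so the two walks take the
  same arc as long as the queried values agree. Final states are sinks, so neither walk can stop
  before the other. Agreement along \<open>p\<close> suffices because \<open>q\<close> is forced to
  follow it. The common first state \<open>u\<close> is arbitrary: the lemma serves both from the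
  root and from the head of an arc.\<close>

lemma final_state_unique:
  assumes "deterministic_bp k V R B"
    and "pre_digraph.awalk (graph B) u p t" "t \<in> final B" "\<forall>e \<in> set p. activated B x e"
    and "pre_digraph.awalk (graph B) u q t'" "t' \<in> final B" "\<forall>e \<in> set q. activated B y e"
    and "\<forall>e \<in> set p. x (query B (tail (graph B) e)) = y (query B (tail (graph B) e))"
  shows "t = t'"
  using assms(2-)
proof (induction p arbitrary: u q)
  case Nil
  then have "u = t" by (simp add: pre_digraph.awalk_def pre_digraph.cas.simps)
  moreover have "out_arcs (graph B) t = {}"
    using assms(1) Nil.prems(2) by (simp add: deterministic_bp_def)
  ultimately show ?case
    using Nil.prems(4)
    by (cases q) (auto simp: pre_digraph.awalk_def pre_digraph.cas.simps out_arcs_def)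
next
  case (Cons e p)
  have wf: "wf_digraph (graph B)"
    using assms(1) by (simp add: deterministic_bp_def fin_digraph_def)
  have e: "e \<in> out_arcs (graph B) u" and u: "u \<in> verts (graph B)"
    using Cons.prems(1) by (auto simp: pre_digraph.awalk_def pre_digraph.cas.simps out_arcs_def)
  then have nonfinal: "u \<notin> final B"
    using assms(1) unfolding deterministic_bp_def by blast
  with Cons.prems(4,5) obtain e' q' where q: "q = e' # q'"
    by (cases q) (auto simp: pre_digraph.awalk_def pre_digraph.cas.simps)
  have e': "e' \<in> out_arcs (graph B) u"
    using Cons.prems(4) by (auto simp: q pre_digraph.awalk_def pre_digraph.cas.simps out_arcs_def)
  have "elabel B e = elabel B e'"
    using Cons.prems(3,6,7) e e' by (simp add: q activated_def out_arcs_def)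
  moreover have "inj_on (elabel B) (out_arcs (graph B) u)"
    using assms(1) nonfinal u by (simp add: deterministic_bp_def bij_betw_def)
  ultimately have "e' = e"
    using e e' by (simp add: inj_on_eq_iff)
  then show ?case
    using Cons.IH[of "head (graph B) e" q'] Cons.prems wf
    by (auto simp: q wf_digraph.awalk_Cons_iff)
qed

text \<open>The even leaves 4 and 6 are left children and the odd leaves 5 and 7 right children, so
  both internal nodes see the pair \<open>(a, b)\<close>. \<open>restrict\<close> is there because
  \<open>computes\<close> ranges over extensional inputs.\<close>

definition diagonal_input :: "nat \<Rightarrow> nat \<Rightarrow> nat \<Rightarrow> nat \<Rightarrow> nat \<Rightarrow> tree_var \<Rightarrow> nat" where
  "diagonal_input k a b x y = restrict
     (\<lambda>v. case v of
        Leaf i \<Rightarrow> if even i then a else b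
      | Entry i c d \<Rightarrow> if c = a \<and> d = b then (if i = 2 then x else y) else 0)
     (sum_mod_vars k)"

lemma diagonal_input_in:
  assumes "a < k" "b < k" "x < k" "y < k"
  shows "diagonal_input k a b x y \<in> sum_mod_vars k \<rightarrow>\<^sub>E {..<k}"
  using assms by (auto simp: diagonal_input_def split: tree_var.split)

lemma sum_mod_diagonal_input:
  assumes "a < k" "b < k"
  shows "sum_mod k (diagonal_input k a b x y) = (x + y) mod k"
  using assms by (simp add: sum_mod_def node_value_def diagonal_input_def sum_mod_vars_def)

lemma diagonal_input_Entry:
  assumes "a < k" "b < k"
  shows "diagonal_input k a b x y (Entry 2 a b) = x"
    and "diagonal_input k a b x y (Entry 3 a b) = y"
  using assms by (auto simp: diagonal_input_def sum_mod_vars_def)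

text \<open>For \<open>i\<close> other than 2 and 3, the case expression would give
  \<open>Entry i a b\<close> the value \<open>y\<close>; such variables lie outside
  \<open>sum_mod_vars k\<close>, where \<open>restrict\<close> returns a fixed default.\<close>

lemma diagonal_input_cong:
  assumes "v \<notin> {Entry 2 a b, Entry 3 a b}"
  shows "diagonal_input k a b x y v = diagonal_input k a b x' y' v"
  using assms by (auto simp: diagonal_input_def sum_mod_vars_def split: tree_var.split)

lemma add_mod_left_cancel:
  fixes x y z k :: nat
  assumes "(x + y) mod k = (x + z) mod k" "y < k" "z < k"
  shows "y = z"
proof -
  \<comment> \<open>Subtracting from both sides of a congruence fails in general for the truncated
    subtraction on \<open>nat\<close>, hence the move to the integers.\<close>
  have "(int x + int y) mod int k = (int x + int z) mod int k"
    using assms(1) by (metis of_nat_add of_nat_mod)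
  then have "(int x + int y - int x) mod int k = (int x + int z - int x) mod int k"
    by (rule mod_diff_cong) simp
  then show ?thesis
    using assms(2,3) by (simp flip: of_nat_mod)
qed

text \<open>How the computation reaches \<open>e\<close> is left out: the walk after
  \<open>e\<close> already fixes the outcome.\<close>

definition last_critical_arc ::
  "nat \<Rightarrow> ('s, 'e, tree_var, nat) branching_program \<Rightarrow> nat \<Rightarrow> nat \<Rightarrow> nat \<Rightarrow> nat \<Rightarrow> 'e \<Rightarrow> bool" where
  "last_critical_arc k B a b x y e \<longleftrightarrow>
     e \<in> arcs (graph B) \<and> query B (tail (graph B) e) \<in> {Entry 2 a b, Entry 3 a b} \<and>
     activated B (diagonal_input k a b x y) e \<and>
     (\<exists>p t. pre_digraph.awalk (graph B) (head (graph B) e) p t \<and> t \<in> final B \<and>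
        (\<forall>e' \<in> set p. activated B (diagonal_input k a b x y) e' \<and>
           query B (tail (graph B) e') \<notin> {Entry 2 a b, Entry 3 a b}) \<and>
        outcome B t = (x + y) mod k)"

text \<open>A computation that never reads either summand would be unchanged by another choice of
  \<open>y\<close>, although the sum changes.\<close>

lemma last_critical_arc_exists:
  fixes B :: "('s, 'e, tree_var, nat) branching_program"
  assumes "k \<ge> 2" "deterministic_bp k (sum_mod_vars k) {..<k} B"
    and computes: "computes k (sum_mod_vars k) B (sum_mod k)"
    and "a < k" "b < k" "x < k" "y < k"
  shows "\<exists>e. last_critical_arc k B a b x y e"
proof -
  let ?crit = "\<lambda>e. query B (tail (graph B) e) \<in> {Entry 2 a b, Entry 3 a b}"
  have walk: "\<exists>p t. pre_digraph.awalk (graph B) (start B) p t \<and>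
      (\<forall>e \<in> set p. activated B (diagonal_input k a b x y') e) \<and>
      t \<in> final B \<and> outcome B t = (x + y') mod k" if "y' < k" for y'
    using computes diagonal_input_in[of a k b x y'] assms(4-6) that
    unfolding computes_def by (metis sum_mod_diagonal_input)
  obtain p t where p: "pre_digraph.awalk (graph B) (start B) p t"
      "\<forall>e \<in> set p. activated B (diagonal_input k a b x y) e"
      "t \<in> final B" "outcome B t = (x + y) mod k"
    using walk[OF \<open>y < k\<close>] by blast
  have "\<exists>e \<in> set p. ?crit e"
  proof (rule ccontr)
    assume none: "\<not> (\<exists>e \<in> set p. ?crit e)"
    \<comment> \<open>The second residue is 1 if \<open>y = 0\<close> and 0 otherwise; both are
      below \<open>k\<close> since \<open>k \<ge> 2\<close>.\<close>
    obtain y' where y': "y' < k" "y' \<noteq> y"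
      using \<open>k \<ge> 2\<close> that[of 0] that[of 1] by (cases "y = 0") auto
    obtain q t' where q: "pre_digraph.awalk (graph B) (start B) q t'"
        "\<forall>e \<in> set q. activated B (diagonal_input k a b x y') e"
        "t' \<in> final B" "outcome B t' = (x + y') mod k"
      using walk[OF y'(1)] by blast
    have "t = t'"
      using none
      by (intro final_state_unique[OF assms(2) p(1,3,2) q(1,3,2)]) (metis diagonal_input_cong)
    then have "(x + y) mod k = (x + y') mod k"
      using p(4) q(4) by simp
    then show False
      using add_mod_left_cancel \<open>y < k\<close> y' by blast
  qed
  then obtain p1 e p2 where split: "p = p1 @ e # p2" "?crit e" "\<forall>e' \<in> set p2. \<not> ?crit e'"
    using split_list_last_prop[of p ?crit] by blast
  have wf: "wf_digraph (graph B)"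
    using assms(2) by (simp add: deterministic_bp_def fin_digraph_def)
  have "e \<in> arcs (graph B)" "pre_digraph.awalk (graph B) (head (graph B) e) p2 t"
    using p(1) wf by (auto simp: split(1) wf_digraph.awalk_append_iff wf_digraph.awalk_Cons_iff)
  then show ?thesis
    unfolding last_critical_arc_def using p(2-4) split
    by (intro exI[of _ e] conjI exI[of _ p2] exI[of _ t]) auto
qed

lemma last_critical_arc_inj:
  fixes B :: "('s, 'e, tree_var, nat) branching_program"
  assumes "deterministic_bp k (sum_mod_vars k) {..<k} B"
    and "last_critical_arc k B a b x y e" "last_critical_arc k B a' b' x' y' e"
    and "a < k" "b < k" "x < k" "y < k" "x' < k" "y' < k"
  shows "a = a' \<and> b = b' \<and> x = x' \<and> y = y'"
proof -
  \<comment> \<open>The variable queried at the tail of \<open>e\<close> carries the pair in its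
    name.\<close>
  have ab: "a' = a" "b' = b"
    using assms(2,3) by (auto simp: last_critical_arc_def)
  obtain p t where p: "pre_digraph.awalk (graph B) (head (graph B) e) p t"
      "t \<in> final B" "\<forall>e' \<in> set p. activated B (diagonal_input k a b x y) e'"
      "\<forall>e' \<in> set p. query B (tail (graph B) e') \<notin> {Entry 2 a b, Entry 3 a b}"
      "outcome B t = (x + y) mod k"
    using assms(2) unfolding last_critical_arc_def by blast
  obtain q t' where q: "pre_digraph.awalk (graph B) (head (graph B) e) q t'"
      "t' \<in> final B" "\<forall>e' \<in> set q. activated B (diagonal_input k a b x' y') e'"
      "outcome B t' = (x' + y') mod k"
    using assms(3) unfolding last_critical_arc_def ab by blast
  have "t = t'"
    using p(4) diagonal_input_cong
    by (intro final_state_unique[OF assms(1) p(1-3) q(1-3)]) blast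
  then have sum: "(x + y) mod k = (x' + y') mod k"
    using p(5) q(4) by simp
  \<comment> \<open>Both inputs activate \<open>e\<close>, so its label is the common value of the
    queried entry: the first summand at node 2, the second at node 3.\<close>
  have "x = x' \<or> y = y'"
    using assms(2-5) by (auto simp: last_critical_arc_def ab activated_def diagonal_input_Entry)
  then show ?thesis
  proof
    assume "x = x'"
    then show ?thesis
      using sum add_mod_left_cancel[of x y k y'] assms(7,9) ab by blast
  next
    assume "y = y'"
    then have "(y + x) mod k = (y + x') mod k"
      using sum by (simp add: add.commute)
    then show ?thesis
      using \<open>y = y'\<close> add_mod_left_cancel[of y x k x'] assms(6,8) ab by blast
  qed
qed

lemma card_arcs_le:
  assumes "deterministic_bp k V R B"
  shows "card (arcs (graph B)) \<le> card (verts (graph B)) * k"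
proof -
  have fin: "fin_digraph (graph B)"
    using assms by (simp add: deterministic_bp_def)
  have "card (out_arcs (graph B) s) \<le> k" if "s \<in> verts (graph B)" for s
  proof (cases "s \<in> final B")
    case False
    then have "bij_betw (elabel B) (out_arcs (graph B) s) {..<k}"
      using assms that by (simp add: deterministic_bp_def)
    then show ?thesis
      by (simp add: bij_betw_same_card)
  qed (use assms in \<open>simp add: deterministic_bp_def\<close>)
  then have "(\<Sum>s \<in> verts (graph B). card (out_arcs (graph B) s)) \<le> card (verts (graph B)) * k"
    by (metis of_nat_id sum_bounded_above)
  moreover have "arcs (graph B) = (\<Union>s \<in> verts (graph B). out_arcs (graph B) s)"
    using fin by (auto simp: fin_digraph_def wf_digraph_def)
  moreover have "finite (verts (graph B))"
    using fin by (simp add: fin_digraph.finite_verts)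
  ultimately show ?thesis
    by (metis card_UN_le order.trans)
qed

theorem theorem5p9:
  fixes k :: nat
    and B :: "('s, 'e, tree_var, nat) branching_program"
  assumes "k \<ge> 2"
    and "deterministic_bp k (sum_mod_vars k) {..<k} B"
    and "computes k (sum_mod_vars k) B (sum_mod k)"
  shows "card (verts (graph B)) \<ge> k ^ 3"
proof -
  let ?D = "{..<k} \<times> {..<k} \<times> {..<k} \<times> {..<k}"
  define arc where "arc = (\<lambda>(a, b, x, y). SOME e. last_critical_arc k B a b x y e)"
  have arc: "last_critical_arc k B a b x y (arc (a, b, x, y))" if "(a, b, x, y) \<in> ?D" for a b x y
    using last_critical_arc_exists[OF assms, of a b x y] that
    by (auto simp: arc_def intro: someI_ex)
  have "inj_on arc ?D"
  proof (rule inj_onI)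
    fix u v
    assume uv: "u \<in> ?D" "v \<in> ?D" "arc u = arc v"
    obtain a b x y a' b' x' y' where eq: "u = (a, b, x, y)" "v = (a', b', x', y')"
      by (metis prod_cases4)
    show "u = v"
      using arc[of a b x y] arc[of a' b' x' y'] uv
        last_critical_arc_inj[OF assms(2), of a b x y "arc u" a' b' x' y']
      by (auto simp: eq)
  qed
  moreover have "arc ` ?D \<subseteq> arcs (graph B)"
    using arc by (force simp: last_critical_arc_def)
  moreover have "finite (arcs (graph B))"
    using assms(2) by (simp add: deterministic_bp_def fin_digraph.finite_arcs)
  ultimately have "card ?D \<le> card (arcs (graph B))"
    by (rule card_inj_on_le)
  also have "\<dots> \<le> card (verts (graph B)) * k"
    using assms(2) by (rule card_arcs_le)
  \<comment> \<open>The domain \<open>?D\<close> has \<open>k ^ 4\<close> elements; one factor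
    \<open>k\<close> is split off to cancel the outdegree bound.\<close>
  finally have "k ^ 3 * k \<le> card (verts (graph B)) * k"
    by (simp add: power3_eq_cube mult.assoc)
  then show ?thesis
    using assms(1) by simp
qed

end
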